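(* Let $n \ge k \ge 1$ and let $\mathcal{F} = \{f_1,\dots,f_n\} \subset \mathbb{R}^k$ be a tight $(n,k)$-frame such that $L(\mathcal{F}) = \operatorname{span}_{\mathbb{Z}}\{f_1,\dots,f_n\}$ is a lattice. Then $\mathcal{F}$ is rational.
   Context: A lattice in $\mathbb{R}^k$ (of full rank $k$) is a discrete co-compact subgroup of $\mathbb{R}^k$. For $n \ge k$, an $(n,k)$-frame is a sequence $\mathcal{F} = \{f_1,\dots,f_n\}$ of vectors in $\mathbb{R}^k$, not necessarily distinct, with $\operatorname{span}_{\mathbb{R}}\{f_1,\dots,f_n\} = \mathbb{R}^k$. The frame is called tight if there is a real constant $\gamma > 0$ such that $\|v\|^2 = \gamma \sum_{i=1}^n \langle v, f_i\rangle^2$ for every $v \in \mathbb{R}^k$, where $\langle\,,\rangle$ and $\|\cdot\|$ are the usual inner product and Euclidean norm. Let $B$ be the $k\times n$ matrix with columns $f_1,\dots,f_n$. The frame $\mathcal{F}$ is called rational if the $n\times n$ Gram matrix $B^\top B$ is a (nonzero real) constant multiple of a rational matrix, i.e. the inner products $\langle f_i, f_j\rangle$, $1 \le i,j\le n$, are rational numbers up to one common constant multiple. *)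

theory Defs
  imports "HOL-Analysis.Analysis"
begin

text \<open>
  \<open>\<real>\<^sup>k\<close> is \<open>real ^ 'k\<close>, and a sequence of \<open>n\<close> (not necessarily distinct) vectors is a function
  from a finite index type \<open>'n\<close>; so \<open>n\<close> is \<open>CARD('n)\<close> and \<open>k\<close> is \<open>CARD('k)\<close>, both at least 1.
\<close>

subsection \<open>Lattices\<close>

definition int_span :: "'a::real_vector set \<Rightarrow> 'a set" where
  "int_span = module.span (\<lambda>(m::int) v. of_int m *\<^sub>R v)"

definition add_subgroup :: "'a::ab_group_add set \<Rightarrow> bool" where
  "add_subgroup L \<longleftrightarrow> 0 \<in> L \<and> (\<forall>x\<in>L. \<forall>y\<in>L. x + y \<in> L) \<and> (\<forall>x\<in>L. - x \<in> L)"

definition add_coset :: "'a::ab_group_add set \<Rightarrow> 'a \<Rightarrow> 'a set" where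
  "add_coset L x = (\<lambda>y. x + y) ` L"

text \<open>The quotient topology on the set of cosets of \<open>L\<close>; see \<open>quotient_map_add_coset\<close> below.\<close>

definition coset_topology :: "'a::{topological_space,ab_group_add} set \<Rightarrow> 'a set topology" where
  "coset_topology L = topology (\<lambda>U. U \<subseteq> range (add_coset L) \<and> open (add_coset L -` U))"

definition cocompact :: "'a::{topological_space,ab_group_add} set \<Rightarrow> bool" where
  "cocompact L \<longleftrightarrow> compact_space (coset_topology L)"

definition is_lattice :: "(real ^ 'k) set \<Rightarrow> bool" where
  "is_lattice L \<longleftrightarrow> add_subgroup L \<and> discrete L \<and> cocompact L"

subsection \<open>Frames\<close>

definition is_frame :: "('n::finite \<Rightarrow> real ^ 'k) \<Rightarrow> bool" where
  "is_frame f \<longleftrightarrow> CARD('k) \<le> CARD('n) \<and> span (range f) = UNIV"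

definition tight_frame :: "('n::finite \<Rightarrow> real ^ 'k) \<Rightarrow> bool" where
  "tight_frame f \<longleftrightarrow> is_frame f \<and>
     (\<exists>\<gamma>>0. \<forall>v. (norm v)\<^sup>2 = \<gamma> * (\<Sum>i\<in>UNIV. (v \<bullet> f i)\<^sup>2))"

text \<open>The \<open>k \<times> n\<close> matrix whose columns are the frame vectors.\<close>

definition frame_matrix :: "('n::finite \<Rightarrow> real ^ 'k) \<Rightarrow> real ^ 'n ^ 'k" where
  "frame_matrix f = (\<chi> r c. f c $ r)"

definition gram_matrix :: "('n::finite \<Rightarrow> real ^ 'k) \<Rightarrow> real ^ 'n ^ 'n" where
  "gram_matrix f = transpose (frame_matrix f) ** frame_matrix f"

definition rational_frame :: "('n::finite \<Rightarrow> real ^ 'k) \<Rightarrow> bool" where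
  "rational_frame f \<longleftrightarrow> is_frame f \<and>
     (\<exists>c Q. c \<noteq> 0 \<and> (\<forall>i j. Q $ i $ j \<in> \<rat>) \<and> gram_matrix f = c *\<^sub>R Q)"

subsection \<open>Basic facts\<close>

lemma module_int_scaleR: "module (\<lambda>(m::int) (v::'a::real_vector). of_int m *\<^sub>R v)"
  by unfold_locales (simp_all add: algebra_simps)

lemma int_span_range:
  fixes f :: "'n::finite \<Rightarrow> 'a::real_vector"
  shows "int_span (range f) = {v. \<exists>m::'n \<Rightarrow> int. v = (\<Sum>i\<in>UNIV. of_int (m i) *\<^sub>R f i)}"
    (is "_ = ?R")
proof -
  interpret M: module "\<lambda>(m::int) (v::'a). of_int m *\<^sub>R v"
    by (rule module_int_scaleR)
  have "M.span (range f) = ?R"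
  proof (rule M.span_unique)
    show "range f \<subseteq> ?R"
    proof
      fix x assume "x \<in> range f"
      then obtain j where "x = f j" by auto
      moreover have "(\<Sum>i\<in>UNIV. of_int (if i = j then 1 else 0) *\<^sub>R f i) =
          (\<Sum>i\<in>UNIV. if i = j then f i else 0)"
        by (rule sum.cong) auto
      ultimately have "x = (\<Sum>i\<in>UNIV. of_int (if i = j then 1 else 0) *\<^sub>R f i)"
        by simp
      then show "x \<in> ?R" by (intro CollectI exI[of _ "\<lambda>i. if i = j then 1 else 0"])
    qed
    show "M.subspace ?R"
      unfolding M.subspace_def
    proof (intro conjI ballI allI)
      have "0 = (\<Sum>i\<in>UNIV. of_int 0 *\<^sub>R f i)" by simp
      then show "0 \<in> ?R" by (intro CollectI exI[of _ "\<lambda>i. 0"])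
    next
      fix x y assume "x \<in> ?R" "y \<in> ?R"
      then obtain m m' :: "'n \<Rightarrow> int" where
        "x = (\<Sum>i\<in>UNIV. of_int (m i) *\<^sub>R f i)" "y = (\<Sum>i\<in>UNIV. of_int (m' i) *\<^sub>R f i)" by blast
      then have "x + y = (\<Sum>i\<in>UNIV. of_int (m i + m' i) *\<^sub>R f i)"
        by (simp add: sum.distrib scaleR_add_left)
      then show "x + y \<in> ?R" by (intro CollectI exI[of _ "\<lambda>i. m i + m' i"])
    next
      fix c x assume "x \<in> ?R"
      then obtain m :: "'n \<Rightarrow> int" where "x = (\<Sum>i\<in>UNIV. of_int (m i) *\<^sub>R f i)" by blast
      then have "of_int c *\<^sub>R x = (\<Sum>i\<in>UNIV. of_int (c * m i) *\<^sub>R f i)"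
        by (simp add: scaleR_sum_right)
      then show "of_int c *\<^sub>R x \<in> ?R" by (intro CollectI exI[of _ "\<lambda>i. c * m i"])
    qed
    fix T assume T: "range f \<subseteq> T" "M.subspace T"
    show "?R \<subseteq> T"
    proof
      fix x assume "x \<in> ?R"
      then obtain m :: "'n \<Rightarrow> int" where x: "x = (\<Sum>i\<in>UNIV. of_int (m i) *\<^sub>R f i)" by blast
      show "x \<in> T"
        unfolding x
      proof (rule M.subspace_sum[OF T(2)])
        fix i
        show "of_int (m i) *\<^sub>R f i \<in> T"
          using M.subspace_scale[OF T(2)] T(1) by blast
      qed
    qed
  qed
  then show ?thesis by (simp add: int_span_def)
qed

lemma openin_coset_topology:
  "openin (coset_topology L) U \<longleftrightarrow> U \<subseteq> range (add_coset L) \<and> open (add_coset L -` U)"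
proof -
  have "istopology (\<lambda>U. U \<subseteq> range (add_coset L) \<and> open (add_coset L -` U))"
    unfolding istopology_def by (auto simp: vimage_Union)
  then show ?thesis by (simp add: coset_topology_def)
qed

lemma topspace_coset_topology: "topspace (coset_topology L) = range (add_coset L)"
proof -
  have "add_coset L -` range (add_coset L) = UNIV" by auto
  then have "openin (coset_topology L) (range (add_coset L))"
    by (simp add: openin_coset_topology)
  then show ?thesis
    by (meson antisym openin_coset_topology openin_subset openin_topspace)
qed

lemma quotient_map_add_coset: "quotient_map euclidean (coset_topology L) (add_coset L)"
  by (auto simp: quotient_map_def topspace_coset_topology openin_coset_topology vimage_def)

lemma gram_matrix_nth: "gram_matrix f $ i $ j = f i \<bullet> f j"
  by (simp add: gram_matrix_def frame_matrix_def transpose_def matrix_matrix_mult_def inner_vec_def)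

end

theory Submission
  imports Defs
begin

text \<open>
  Tightness says that \<open>\<gamma>\<close> times the Gram matrix is the orthogonal projection of \<open>\<real>\<^sup>n\<close> along the
  space \<open>K\<close> of real linear relations between the frame vectors. By Dirichlet's theorem a real
  relation has multiples that are as close as we like to integer vectors; these are mapped to short
  vectors of the lattice, hence to \<open>0\<close>, so \<open>K\<close> is spanned by integer relations. An orthogonal
  projection along a rational subspace is rational: a \<open>\<rat>\<close>-linear functional on \<open>\<real>\<close> that vanishes
  on \<open>\<rat>\<close>, applied coordinatewise to the projection of a rational vector, gives an element
  of \<open>K \<inter> K\<^sup>\<bottom> = 0\<close>.
\<close>

text \<open>As \<open>a\<close> is irrational, \<open>a\<close> and 1 are linearly independent over
  the rationals, so a \<rat>-linear map with values 1 at \<open>a\<close> and 0 at 1 exists by basis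
  extension.\<close>

lemma rat_linear_functional_exists:
  fixes a :: real
  assumes "a \<notin> \<rat>"
  obtains \<phi> :: "real \<Rightarrow> real"
  where "\<And>x y. \<phi> (x + y) = \<phi> x + \<phi> y" "\<And>q x. q \<in> \<rat> \<Longrightarrow> \<phi> (q * x) = q * \<phi> x"
    "\<And>q. q \<in> \<rat> \<Longrightarrow> \<phi> q = 0" "\<phi> a = 1"
proof -
  interpret vector_space_pair "\<lambda>(q::rat) (x::real). of_rat q * x" "\<lambda>(q::rat) (x::real). of_rat q * x"
    by unfold_locales (simp_all add: algebra_simps of_rat_add of_rat_mult)
  have ind1: "vs1.independent {1}"
    by simp
  have "a \<notin> vs1.span {1}"
    using assms by (auto simp: vs1.span_singleton)
  with ind1 have ind: "vs1.independent {a, 1}"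
    by (simp add: vs1.independent_insert)
  obtain \<phi> where lin: "Vector_Spaces.linear (\<lambda>(q::rat) (x::real). of_rat q * x) (\<lambda>(q::rat) (x::real). of_rat q * x) \<phi>"
    and \<phi>: "\<forall>x\<in>{a, 1}. \<phi> x = (if x = a then 1 else 0)"
    using linear_independent_extend[OF ind, of "\<lambda>x. if x = a then 1 else 0"] by blast
  have add: "\<phi> (x + y) = \<phi> x + \<phi> y" for x y
    using lin by (rule linear_add)
  have scale: "\<phi> (q * x) = q * \<phi> x" if "q \<in> \<rat>" for q x
    using that linear_scale[OF lin] by (auto elim!: Rats_cases)
  have "a \<noteq> 1"
    using assms by auto
  then have "\<phi> 1 = 0" "\<phi> a = 1"
    using \<phi> by auto
  moreover have "\<phi> q = 0" if "q \<in> \<rat>" for q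
    using scale[OF that, of 1] \<open>\<phi> 1 = 0\<close> by simp
  ultimately show ?thesis
    using add scale that by blast
qed

text \<open>The last two hypotheses make \<open>x\<close> the orthogonal projection of
  \<open>e\<close> along the span of \<open>M\<close>. The functional \<phi> is chosen nonzero at a
  supposedly irrational coordinate of \<open>x\<close>.\<close>

lemma orthogonal_projection_rational:
  fixes x e :: "real ^ 'n" and M :: "(real ^ 'n) set"
  assumes M: "\<And>m i. m \<in> M \<Longrightarrow> m $ i \<in> \<rat>"
    and e: "\<And>i. e $ i \<in> \<rat>"
    and x: "x - e \<in> span M"
    and orth: "\<And>m. m \<in> M \<Longrightarrow> x \<bullet> m = 0"
  shows "x $ i \<in> \<rat>"
proof (rule ccontr)
  assume "x $ i \<notin> \<rat>"
  then obtain \<phi> :: "real \<Rightarrow> real"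
    where add: "\<And>x y. \<phi> (x + y) = \<phi> x + \<phi> y"
      and scale: "\<And>q x. q \<in> \<rat> \<Longrightarrow> \<phi> (q * x) = q * \<phi> x"
      and rat: "\<And>q. q \<in> \<rat> \<Longrightarrow> \<phi> q = 0" and "\<phi> (x $ i) = 1"
    using rat_linear_functional_exists by blast
  have sum: "\<phi> (\<Sum>j\<in>A. g j) = (\<Sum>j\<in>A. \<phi> (g j))" for g and A :: "'n set"
    by (induction A rule: infinite_finite_induct) (simp_all add: add rat)
  define \<Phi> :: "real ^ 'n \<Rightarrow> real ^ 'n" where "\<Phi> v = (\<chi> j. \<phi> (v $ j))" for v
  have \<Phi>_add: "\<Phi> (v + w) = \<Phi> v + \<Phi> w" for v w
    by (simp add: \<Phi>_def vec_eq_iff add)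
  have \<Phi>_M: "\<Phi> (r *\<^sub>R m) = \<phi> r *\<^sub>R m" if "m \<in> M" for r m
    using scale[OF M[OF that], of _ r] by (simp add: \<Phi>_def vec_eq_iff mult.commute)
  \<comment> \<open>The map \<Phi> is only \<rat>-linear. Quantifying over all real \<open>r\<close>
    makes the claim stable under real scaling, so that it defines a subspace and span induction
    applies.\<close>
  have \<Phi>_span: "\<forall>r. \<Phi> (r *\<^sub>R v) \<in> span M" if "v \<in> span M" for v
    using that
  proof (induction rule: span_induct)
    case base
    show ?case
      unfolding subspace_def
      by (auto simp: scaleR_add_right \<Phi>_add span_add)
        (simp add: \<Phi>_def rat zero_vec_def[symmetric] span_zero)
  next
    case (step m)
    then show ?case
      by (simp add: \<Phi>_M span_base span_scale)
  qed
  have "\<Phi> e = 0"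
    by (simp add: \<Phi>_def vec_eq_iff rat e)
  then have "\<Phi> x = \<Phi> (x - e)"
    using \<Phi>_add[of "x - e" e] by simp
  also have "\<dots> \<in> span M"
    using \<Phi>_span[OF x, THEN spec, of 1] by simp
  finally have "\<Phi> x \<in> span M" .
  moreover have "orthogonal (\<Phi> x) m" if "m \<in> M" for m
  proof -
    \<comment> \<open>The coordinates of \<open>m\<close> are rational, so they can be moved inside
      \<phi>.\<close>
    have "\<Phi> x \<bullet> m = (\<Sum>j\<in>UNIV. \<phi> (m $ j * x $ j))"
      by (simp add: \<Phi>_def inner_vec_def scale M[OF that] mult.commute)
    also have "\<dots> = \<phi> (x \<bullet> m)"
      by (simp add: sum inner_vec_def mult.commute)
    finally show ?thesis
      by (simp add: orth[OF that] rat orthogonal_def)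
  qed
  ultimately have "\<Phi> x = 0"
    using orthogonal_to_span orthogonal_self by blast
  then have "\<phi> (x $ i) = 0"
    by (simp add: \<Phi>_def vec_eq_iff)
  with \<open>\<phi> (x $ i) = 1\<close> show False
    by simp
qed

text \<open>Simultaneous Dirichlet approximation with precision \<open>1 / N\<close> below
  \<epsilon>, carried over to the coordinates by a numbering \<open>h\<close> of the index
  type.\<close>

lemma Dirichlet_approx_vec:
  fixes v :: "real ^ 'n"
  assumes "0 < \<epsilon>"
  obtains q :: int and p :: "'n \<Rightarrow> int"
  where "0 < q" "\<And>i. \<bar>of_int q * v $ i - of_int (p i)\<bar> < \<epsilon>"
proof -
  obtain h :: "'n \<Rightarrow> nat" where h: "bij_betw h UNIV {..<CARD('n)}"
    using ex_bij_betw_finite_nat[of "UNIV :: 'n set"] by (auto simp: atLeast0LessThan)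
  obtain N :: nat where N: "0 < N" "1 / real N < \<epsilon>"
    using assms by (metis inverse_eq_divide reals_Archimedean zero_less_Suc)
  obtain q p where "0 < q"
    and *: "\<And>k. k < CARD('n) \<Longrightarrow>
      \<bar>of_int q * v $ inv h k - of_int (p k)\<bar> < 1 / real N"
    using Dirichlet_approx_simult[OF N(1), of "CARD('n)" "\<lambda>k. v $ inv h k"] by blast
  have "\<bar>of_int q * v $ i - of_int (p (h i))\<bar> < \<epsilon>" for i
  proof -
    have "h i < CARD('n)" "inv h (h i) = i"
      using h by (auto simp: bij_betw_def)
    then show ?thesis
      using *[of "h i"] N(2) by simp
  qed
  with \<open>0 < q\<close> show ?thesis
    by (rule that)
qed

text \<open>Dividing the integer relations near multiples of \<open>v\<close> by their multipliers
  approximates \<open>v\<close> inside the span, and a subspace of finite dimension is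
  closed.\<close>

lemma relations_in_span_integer_relations:
  fixes f :: "'n::finite \<Rightarrow> 'a::euclidean_space" and v :: "real ^ 'n"
  assumes disc: "discrete (int_span (range f))"
    and v: "(\<Sum>i\<in>UNIV. v $ i *\<^sub>R f i) = 0"
  shows "v \<in> span {m. (\<forall>i. m $ i \<in> \<int>) \<and> (\<Sum>i\<in>UNIV. m $ i *\<^sub>R f i) = 0}" (is "_ \<in> span ?N")
proof -
  have "0 \<in> int_span (range f)"
    unfolding int_span_range by (intro CollectI exI[of _ "\<lambda>_. 0"]) simp
  with disc have "0 isolated_in int_span (range f)"
    by (simp add: discrete_def)
  then obtain r where "0 < r" and r: "\<And>w. w \<in> int_span (range f) \<Longrightarrow> norm w < r \<Longrightarrow> w = 0"
    unfolding isolated_in_dist_Ex_iff by auto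
  \<comment> \<open>The summand 1 keeps \<open>C\<close> positive even if every \<open>f i\<close>
    is 0, and makes the later bound by \<open>\<delta> * C\<close> strict.\<close>
  define C where "C = (\<Sum>i\<in>UNIV. norm (f i)) + 1"
  have "0 < C"
    unfolding C_def by (intro add_nonneg_pos sum_nonneg) auto
  have "v \<in> closure (span ?N)"
    unfolding closure_approachable
  proof (intro allI impI)
    fix \<epsilon> :: real assume "0 < \<epsilon>"
    \<comment> \<open>The first bound makes the lattice vector given by \<open>m\<close> shorter
      than \<open>r\<close>; the second keeps the sum of the coordinate errors below
      \<epsilon>.\<close>
    define \<delta> where "\<delta> = min (r / C) (\<epsilon> / CARD('n))"
    have "0 < \<delta>"
      using \<open>0 < r\<close> \<open>0 < C\<close> \<open>0 < \<epsilon>\<close> by (simp add: \<delta>_def)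
    then obtain q :: int and p :: "'n \<Rightarrow> int"
      where "0 < q" and p: "\<And>i. \<bar>of_int q * v $ i - of_int (p i)\<bar> < \<delta>"
      using Dirichlet_approx_vec by blast
    define m :: "real ^ 'n" where "m = (\<chi> i. of_int (p i))"
    have "(\<Sum>i\<in>UNIV. (of_int q * v $ i) *\<^sub>R f i) = of_int q *\<^sub>R (\<Sum>i\<in>UNIV. v $ i *\<^sub>R f i)"
      by (simp add: scaleR_sum_right)
    \<comment> \<open>Since \<open>v\<close> is a relation, only the approximation error contributes
      to the lattice vector.\<close>
    then have "(\<Sum>i\<in>UNIV. m $ i *\<^sub>R f i) = - (\<Sum>i\<in>UNIV. (of_int q * v $ i - m $ i) *\<^sub>R f i)"
      by (simp add: v scaleR_diff_left sum_subtractf)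
    then have "norm (\<Sum>i\<in>UNIV. m $ i *\<^sub>R f i) \<le> (\<Sum>i\<in>UNIV. norm ((of_int q * v $ i - m $ i) *\<^sub>R f i))"
      by (simp add: norm_sum del: norm_scaleR)
    also have "\<dots> \<le> (\<Sum>i\<in>UNIV. \<delta> * norm (f i))"
      using p by (intro sum_mono) (simp add: m_def mult_right_mono less_imp_le)
    also have "\<dots> < \<delta> * C"
      using \<open>0 < \<delta>\<close> by (simp add: C_def sum_distrib_left[symmetric] distrib_left)
    also have "\<dots> \<le> r"
      using \<open>0 < C\<close> by (simp add: \<delta>_def pos_le_divide_eq[symmetric])
    finally have "norm (\<Sum>i\<in>UNIV. m $ i *\<^sub>R f i) < r" .
    moreover have "(\<Sum>i\<in>UNIV. m $ i *\<^sub>R f i) \<in> int_span (range f)"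
      by (auto simp: int_span_range m_def)
    ultimately have "m \<in> ?N"
      using r by (simp add: m_def)
    then have "(1 / of_int q) *\<^sub>R m \<in> span ?N"
      by (intro span_scale span_base)
    moreover have "dist ((1 / of_int q) *\<^sub>R m) v < \<epsilon>"
    proof -
      have "norm (of_int q *\<^sub>R v - m) \<le> (\<Sum>i\<in>UNIV. \<bar>(of_int q *\<^sub>R v - m) $ i\<bar>)"
        by (rule norm_le_l1_cart)
      also have "\<dots> < (\<Sum>i\<in>(UNIV::'n set). \<delta>)"
        using p by (intro sum_strict_mono) (auto simp: m_def)
      also have "\<dots> \<le> \<epsilon>"
        by (simp add: \<delta>_def min_def field_simps)
      finally have *: "norm (of_int q *\<^sub>R v - m) < \<epsilon>" .
      have "v - (1 / of_int q) *\<^sub>R m = (1 / of_int q) *\<^sub>R (of_int q *\<^sub>R v - m)"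
        using \<open>0 < q\<close> by (simp add: scaleR_diff_right)
      then have "dist ((1 / of_int q) *\<^sub>R m) v = norm (of_int q *\<^sub>R v - m) / of_int q"
        using \<open>0 < q\<close> by (simp add: dist_norm norm_minus_commute)
      \<comment> \<open>The integer \<open>q\<close> is at least 1, so dividing by it does not
        increase the error.\<close>
      also have "\<dots> \<le> norm (of_int q *\<^sub>R v - m)"
        using \<open>0 < q\<close> by (simp add: divide_le_eq mult_le_cancel_left1)
      finally show ?thesis
        using * by simp
    qed
    ultimately show "\<exists>y\<in>span ?N. dist y v < \<epsilon>"
      by blast
  qed
  then show ?thesis
    by (simp add: closure_closed closed_subspace)
qed

text \<open>Polarizing the norm identity gives the same identity for inner products, which determine
  a vector.\<close>

lemma tight_frame_reconstruction:
  fixes f :: "'n::finite \<Rightarrow> 'a::real_inner"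
  assumes tight: "\<And>v. (norm v)\<^sup>2 = \<gamma> * (\<Sum>i\<in>UNIV. (v \<bullet> f i)\<^sup>2)"
  shows "(\<Sum>i\<in>UNIV. (\<gamma> * (v \<bullet> f i)) *\<^sub>R f i) = v"
proof -
  have polar: "v \<bullet> w = \<gamma> * (\<Sum>i\<in>UNIV. (v \<bullet> f i) * (w \<bullet> f i))" for w
  proof -
    have "(norm (v + w))\<^sup>2 = (norm v)\<^sup>2 + (norm w)\<^sup>2 + 2 * (v \<bullet> w)"
      by (simp add: power2_norm_eq_inner inner_add inner_commute)
    moreover have "\<gamma> * (\<Sum>i\<in>UNIV. ((v + w) \<bullet> f i)\<^sup>2) = \<gamma> * (\<Sum>i\<in>UNIV. (v \<bullet> f i)\<^sup>2)
        + \<gamma> * (\<Sum>i\<in>UNIV. (w \<bullet> f i)\<^sup>2) + 2 * (\<gamma> * (\<Sum>i\<in>UNIV. (v \<bullet> f i) * (w \<bullet> f i)))"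
      by (simp add: inner_add_left power2_sum sum.distrib sum_distrib_left algebra_simps)
    ultimately show ?thesis
      using tight[of "v + w"] tight[of v] tight[of w] by simp
  qed
  show ?thesis
  proof (rule vector_eq_rdot[THEN iffD1], rule allI)
    fix w
    show "(\<Sum>i\<in>UNIV. (\<gamma> * (v \<bullet> f i)) *\<^sub>R f i) \<bullet> w = v \<bullet> w"
      by (simp add: polar[of w] inner_sum_left sum_distrib_left inner_commute[of w] mult.assoc)
  qed
qed

theorem theorem1p1:
  fixes f :: "'n::finite \<Rightarrow> real ^ 'k"
  assumes "tight_frame f"
    and "is_lattice (int_span (range f))"
  shows "rational_frame f"
proof -
  obtain \<gamma> where frame: "is_frame f" and "0 < \<gamma>"
    and tight: "\<And>v. (norm v)\<^sup>2 = \<gamma> * (\<Sum>i\<in>UNIV. (v \<bullet> f i)\<^sup>2)"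
    using assms(1) by (auto simp: tight_frame_def)
  let ?N = "{m :: real ^ 'n. (\<forall>i. m $ i \<in> \<int>) \<and> (\<Sum>i\<in>UNIV. m $ i *\<^sub>R f i) = 0}"
  \<comment> \<open>Row \<open>j\<close> of \<open>Q\<close> will be the projection of the
    \<open>j\<close>-th standard basis vector along the real relations.\<close>
  define Q :: "real ^ 'n ^ 'n" where "Q = \<gamma> *\<^sub>R gram_matrix f"
  have Q: "Q $ j $ i = \<gamma> * (f j \<bullet> f i)" for i j
    by (simp add: Q_def gram_matrix_nth)
  have "Q $ j $ i \<in> \<rat>" for i j
  proof (rule orthogonal_projection_rational[where M = ?N and e = "axis j 1"])
    show "m $ l \<in> \<rat>" if "m \<in> ?N" for m l
      using that Ints_subset_Rats by blast
    show "axis j (1::real) $ l \<in> \<rat>" for l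
      by (simp add: axis_def)
    have "(\<Sum>l\<in>UNIV. axis j 1 $ l *\<^sub>R f l) = (\<Sum>l\<in>UNIV. if l = j then f l else 0)"
      by (intro sum.cong) (auto simp: axis_def)
    \<comment> \<open>Reconstruction of \<open>f j\<close> says that row \<open>j\<close> and the
      basis vector are the coefficients of the same vector, so their difference is a
      relation.\<close>
    then have "(\<Sum>l\<in>UNIV. (Q $ j - axis j 1) $ l *\<^sub>R f l) = 0"
      using tight_frame_reconstruction[OF tight, of "f j"]
      by (simp add: Q scaleR_diff_left sum_subtractf)
    then show "Q $ j - axis j 1 \<in> span ?N"
      using assms(2) by (intro relations_in_span_integer_relations) (auto simp: is_lattice_def)
    show "Q $ j \<bullet> m = 0" if "m \<in> ?N" for m
    proof -
      \<comment> \<open>Pairing row \<open>j\<close> with \<open>m\<close> amounts to pairing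
        \<open>f j\<close> with the combination that \<open>m\<close> encodes, which is 0 for a
        relation.\<close>
      have "Q $ j \<bullet> m = \<gamma> * (f j \<bullet> (\<Sum>l\<in>UNIV. m $ l *\<^sub>R f l))"
        by (simp add: inner_vec_def[of "Q $ j"] Q inner_sum_right sum_distrib_left algebra_simps)
      with that show ?thesis
        by simp
    qed
  qed
  moreover have "gram_matrix f = inverse \<gamma> *\<^sub>R Q"
    using \<open>0 < \<gamma>\<close> by (simp add: Q_def)
  ultimately show ?thesis
    using frame \<open>0 < \<gamma>\<close> unfolding rational_frame_def
    by (intro conjI exI[of _ "inverse \<gamma>"] exI[of _ Q]) auto
qed

end
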